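(* Let $K$ be an algebraically closed non-archimedean field with valuation $v$, valuation ring $R$ and residue field $k$ with $\mathrm{char}(k)\neq2,3$. Let $E/K$ be an elliptic curve with $v(j(E))<0$, given by a minimal Weierstrass model $W$ of the form $$y^2=x^3+a(x-b)^2,\qquad a,b\in R,$$ such that there is a point $P\in E[3](K)$ with $x(P)=0$ that reduces to the singular point of the reduced curve $\overline{E}$ of $W$. Let $a'\in K$ be a square root of $a$, and define the functions $$f=\frac{x^2}{y-a'(x-b)},\qquad g=\frac{x^2}{y+a'(x-b)}$$ in the function field $K(E)$. Then the image in $\mathbb{P}^2$ of the embedding $E\to\mathbb{P}^2$ induced by $(f,g)$ is cut out by the affine equation $$fg^2+2a'fg-f^2g-2a'b=0.$$
   Context: The embedding induced by $(f,g)$ is the morphism $E\to\mathbb{P}^2$ extending $[f:g:1]$. In the affine equation, $f$ and $g$ denote the corresponding affine coordinates on $\mathbb{P}^2$; that the image is cut out by the affine equation means that it is the projective plane curve defined by the homogenization of that equation. $v:K^*\to\mathbb{R}$ is extended by $v(0)=\infty$; $R=\{z\in K: v(z)\ge0\}$, $\mathfrak{m}$ is its maximal ideal and $k=R/\mathfrak{m}$. An integral Weierstrass equation for $E$ is a Weierstrass equation $y^2+a_1xy+a_3y=x^3+a_2x^2+a_4x+a_6$ of $E$ with all $a_i\in R$. It is minimal (a minimal Weierstrass model) if the valuation $v(\Delta)$ of its discriminant is minimal among all integral Weierstrass equations for $E$. The reduced curve $\overline{E}/k$ is defined by reducing the $a_i$ modulo $\mathfrak{m}$. The reduction $\overline{P}\in\overline{E}(k)$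 of $P\in E(K)$ is obtained by scaling projective coordinates of $P$ so that they lie in $R$ and at least one is a unit, and then reducing modulo $\mathfrak{m}$. When $v(j(E))<0$, the reduced curve $\overline{E}$ of a minimal model has a unique singular point, which is a node. $E[3](K)$ is the group of points $P\in E(K)$ with $3P=\mathcal{O}$. *)

theory Defs
  imports
    "HOL-Computational_Algebra.Polynomial"
    "HOL-Library.Extended_Real"
    "HOL-Algebra.QuotRing"
begin

section \<open>Valuations, valuation ring and residue field\<close>

definition nonarch_valuation :: "('a::field \<Rightarrow> ereal) \<Rightarrow> bool" where
  "nonarch_valuation v \<longleftrightarrow>
     (\<forall>x. v x \<noteq> -\<infinity>) \<and> (\<forall>x. v x = \<infinity> \<longleftrightarrow> x = 0) \<and>
     (\<forall>x y. v (x * y) = v x + v y) \<and>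
     (\<forall>x y. min (v x) (v y) \<le> v (x + y))"

definition valuation_ring :: "('a::field \<Rightarrow> ereal) \<Rightarrow> 'a ring" where
  "valuation_ring v =
     \<lparr>carrier = {z. 0 \<le> v z}, mult = (*), one = 1, zero = 0, add = (+)\<rparr>"

definition valuation_ideal :: "('a::field \<Rightarrow> ereal) \<Rightarrow> 'a set" where
  "valuation_ideal v = {z. 0 < v z}"

definition residue_field :: "('a::field \<Rightarrow> ereal) \<Rightarrow> 'a set ring" where
  "residue_field v = valuation_ring v Quot valuation_ideal v"

definition residue :: "('a::field \<Rightarrow> ereal) \<Rightarrow> 'a \<Rightarrow> 'a set" where
  "residue v z = valuation_ideal v +>\<^bsub>valuation_ring v\<^esub> z"

text \<open>The characteristic of a ring with explicit carrier, as in the definition of \<open>CHAR\<close>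
  for type classes.\<close>

definition ring_char :: "('b, 'm) ring_scheme \<Rightarrow> nat" where
  "ring_char k = Gcd {n::nat. add_pow k n \<one>\<^bsub>k\<^esub> = \<zero>\<^bsub>k\<^esub>}"


section \<open>The projective plane over an algebraically closed field\<close>

type_synonym 'a triple = "'a \<times> 'a \<times> 'a"

text \<open>A point of the projective plane is the set of all its homogeneous coordinate triples.\<close>

definition proj :: "'a::field triple \<Rightarrow> 'a triple set" where
  "proj = (\<lambda>(X, Y, Z). {(c * X, c * Y, c * Z) | c. c \<noteq> 0})"

definition proj_plane :: "'a::field triple set set" where
  "proj_plane = proj ` (UNIV - {(0, 0, 0)})"

text \<open>Homogeneous polynomials in three variables, as functions. Algebraically closed fields are
  infinite, so a polynomial is determined by its polynomial function.\<close>

inductive form :: "nat \<Rightarrow> ('a::alg_closed_field triple \<Rightarrow> 'a) \<Rightarrow> bool" where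
  form_X: "form 1 (\<lambda>(X, Y, Z). X)"
| form_Y: "form 1 (\<lambda>(X, Y, Z). Y)"
| form_Z: "form 1 (\<lambda>(X, Y, Z). Z)"
| form_const: "form 0 (\<lambda>_. c)"
| form_add: "form n F \<Longrightarrow> form n G \<Longrightarrow> form n (\<lambda>t. F t + G t)"
| form_mult: "form m F \<Longrightarrow> form n G \<Longrightarrow> form (m + n) (\<lambda>t. F t * G t)"

definition zero_locus :: "('a::field triple \<Rightarrow> 'a) \<Rightarrow> 'a triple set set" where
  "zero_locus H = {proj t | t. t \<noteq> (0, 0, 0) \<and> H t = 0}"

text \<open>Morphisms between projective sets: in a Zariski neighbourhood (here \<open>H \<noteq> 0\<close>) of
  every point, the map is given by three forms of equal degree without common zero.\<close>

definition morphism ::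
  "'a::alg_closed_field triple set set \<Rightarrow> 'a triple set set \<Rightarrow>
     ('a triple set \<Rightarrow> 'a triple set) \<Rightarrow> bool" where
  "morphism A B \<phi> \<longleftrightarrow> \<phi> ` A \<subseteq> B \<and>
     (\<forall>P\<in>A. \<exists>n F\<^sub>0 F\<^sub>1 F\<^sub>2 m H.
        form n F\<^sub>0 \<and> form n F\<^sub>1 \<and> form n F\<^sub>2 \<and> form m H \<and> (\<exists>t\<in>P. H t \<noteq> 0) \<and>
        (\<forall>t. proj t \<in> A \<and> H t \<noteq> 0 \<longrightarrow>
           (F\<^sub>0 t, F\<^sub>1 t, F\<^sub>2 t) \<noteq> (0, 0, 0) \<and> \<phi> (proj t) = proj (F\<^sub>0 t, F\<^sub>1 t, F\<^sub>2 t)))"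

definition isomorphism ::
  "'a::alg_closed_field triple set set \<Rightarrow> 'a triple set set \<Rightarrow>
     ('a triple set \<Rightarrow> 'a triple set) \<Rightarrow> bool" where
  "isomorphism A B \<phi> \<longleftrightarrow>
     bij_betw \<phi> A B \<and> morphism A B \<phi> \<and> morphism B A (inv_into A \<phi>)"

definition embedding ::
  "'a::alg_closed_field triple set set \<Rightarrow> ('a triple set \<Rightarrow> 'a triple set) \<Rightarrow> bool" where
  "embedding A \<phi> \<longleftrightarrow> \<phi> ` A \<subseteq> proj_plane \<and> isomorphism A (\<phi> ` A) \<phi>"

text \<open>\<open>S\<close> is the plane curve defined by the form \<open>H\<close>, with its reduced scheme
  structure: \<open>S\<close> is the zero locus of \<open>H\<close>, and \<open>H\<close> generates the homogeneous ideal
  of \<open>S\<close> (this excludes multiple components in \<open>H\<close>).\<close>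

definition cut_out_by ::
  "'a::alg_closed_field triple set set \<Rightarrow> ('a triple \<Rightarrow> 'a) \<Rightarrow> bool" where
  "cut_out_by S H \<longleftrightarrow> S = zero_locus H \<and>
     (\<forall>n F. form n F \<and> (\<forall>t. proj t \<in> S \<longrightarrow> F t = 0) \<longrightarrow>
        (\<exists>m G. form m G \<and> F = (\<lambda>t. H t * G t)))"


section \<open>Weierstrass equations\<close>

text \<open>\<open>Weierstrass a1 a2 a3 a4 a6\<close> stands for
  \<open>y\<^sup>2 + a1 x y + a3 y = x\<^sup>3 + a2 x\<^sup>2 + a4 x + a6\<close>.\<close>

datatype 'a weierstrass = Weierstrass (a1: 'a) (a2: 'a) (a3: 'a) (a4: 'a) (a6: 'a)

definition b2 :: "'a::field weierstrass \<Rightarrow> 'a" where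
  "b2 W = a1 W ^ 2 + 4 * a2 W"
definition b4 :: "'a::field weierstrass \<Rightarrow> 'a" where
  "b4 W = 2 * a4 W + a1 W * a3 W"
definition b6 :: "'a::field weierstrass \<Rightarrow> 'a" where
  "b6 W = a3 W ^ 2 + 4 * a6 W"
definition b8 :: "'a::field weierstrass \<Rightarrow> 'a" where
  "b8 W = a1 W ^ 2 * a6 W + 4 * a2 W * a6 W - a1 W * a3 W * a4 W + a2 W * a3 W ^ 2 - a4 W ^ 2"
definition c4 :: "'a::field weierstrass \<Rightarrow> 'a" where
  "c4 W = b2 W ^ 2 - 24 * b4 W"
definition discriminant :: "'a::field weierstrass \<Rightarrow> 'a" where
  "discriminant W =
     - (b2 W ^ 2 * b8 W) - 8 * b4 W ^ 3 - 27 * b6 W ^ 2 + 9 * b2 W * b4 W * b6 W"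
definition j_invariant :: "'a::field weierstrass \<Rightarrow> 'a" where
  "j_invariant W = c4 W ^ 3 / discriminant W"

definition elliptic :: "'a::field weierstrass \<Rightarrow> bool" where
  "elliptic W \<longleftrightarrow> discriminant W \<noteq> 0"

definition weierstrass_form :: "'a::field weierstrass \<Rightarrow> 'a triple \<Rightarrow> 'a" where
  "weierstrass_form W = (\<lambda>(X, Y, Z).
     Y ^ 2 * Z + a1 W * X * Y * Z + a3 W * Y * Z ^ 2
       - (X ^ 3 + a2 W * X ^ 2 * Z + a4 W * X * Z ^ 2 + a6 W * Z ^ 3))"

definition curve :: "'a::field weierstrass \<Rightarrow> 'a triple set set" where
  "curve W = zero_locus (weierstrass_form W)"

text \<open>\<open>W'\<close> is a Weierstrass equation for the elliptic curve given by \<open>W\<close>: the curves are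
  isomorphic, with the points at infinity corresponding to each other.\<close>

definition same_elliptic_curve ::
  "'a::alg_closed_field weierstrass \<Rightarrow> 'a weierstrass \<Rightarrow> bool" where
  "same_elliptic_curve W W' \<longleftrightarrow>
     (\<exists>\<phi>. isomorphism (curve W) (curve W') \<phi> \<and> \<phi> (proj (0, 1, 0)) = proj (0, 1, 0))"

definition integral_weierstrass :: "('a::field \<Rightarrow> ereal) \<Rightarrow> 'a weierstrass \<Rightarrow> bool" where
  "integral_weierstrass v W \<longleftrightarrow> set_weierstrass W \<subseteq> carrier (valuation_ring v)"

definition minimal_weierstrass ::
  "('a::alg_closed_field \<Rightarrow> ereal) \<Rightarrow> 'a weierstrass \<Rightarrow> bool" where
  "minimal_weierstrass v W \<longleftrightarrow> integral_weierstrass v W \<and>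
     (\<forall>W'. integral_weierstrass v W' \<and> same_elliptic_curve W W' \<longrightarrow>
        v (discriminant W) \<le> v (discriminant W'))"


section \<open>The group law\<close>

datatype 'a point = Infinity | Affine 'a 'a

fun point_proj :: "'a::field point \<Rightarrow> 'a triple set" where
  "point_proj Infinity = proj (0, 1, 0)"
| "point_proj (Affine x y) = proj (x, y, 1)"

definition points :: "'a::field weierstrass \<Rightarrow> 'a point set" where
  "points W = {P. point_proj P \<in> curve W}"

text \<open>Chord and tangent: \<open>y = l x + m\<close> is the line through the two points (the tangent line if
  they coincide).\<close>

fun add_points :: "'a::field weierstrass \<Rightarrow> 'a point \<Rightarrow> 'a point \<Rightarrow> 'a point" where
  "add_points W Infinity Q = Q"
| "add_points W P Infinity = P"
| "add_points W (Affine x\<^sub>1 y\<^sub>1) (Affine x\<^sub>2 y\<^sub>2) =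
     (if x\<^sub>1 = x\<^sub>2 \<and> y\<^sub>1 + y\<^sub>2 + a1 W * x\<^sub>2 + a3 W = 0 then Infinity
      else
        (let l = (if x\<^sub>1 \<noteq> x\<^sub>2 then (y\<^sub>2 - y\<^sub>1) / (x\<^sub>2 - x\<^sub>1)
                  else (3 * x\<^sub>1 ^ 2 + 2 * a2 W * x\<^sub>1 + a4 W - a1 W * y\<^sub>1)
                         / (2 * y\<^sub>1 + a1 W * x\<^sub>1 + a3 W));
             m = y\<^sub>1 - l * x\<^sub>1;
             x\<^sub>3 = l ^ 2 + a1 W * l - a2 W - x\<^sub>1 - x\<^sub>2
         in Affine x\<^sub>3 (- (l + a1 W) * x\<^sub>3 - m - a3 W)))"

fun mult_point :: "'a::field weierstrass \<Rightarrow> nat \<Rightarrow> 'a point \<Rightarrow> 'a point" where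
  "mult_point W 0 P = Infinity"
| "mult_point W (Suc n) P = add_points W P (mult_point W n P)"

definition torsion :: "'a::field weierstrass \<Rightarrow> nat \<Rightarrow> 'a point set" where
  "torsion W n = {P \<in> points W. mult_point W n P = Infinity}"


section \<open>Reduction\<close>

context
  fixes k :: "('b, 'm) ring_scheme" (structure)
begin

definition ring_proj :: "'b triple \<Rightarrow> 'b triple set" where
  "ring_proj = (\<lambda>(X, Y, Z). {(c \<otimes> X, c \<otimes> Y, c \<otimes> Z) | c. c \<in> carrier k - {\<zero>}})"

text \<open>The singular points in the projective plane over \<open>k\<close> of the curve with the given Weierstrass
  equation: common zeros of the homogeneous Weierstrass polynomial
  \<open>Y\<^sup>2 Z + a1 X Y Z + a3 Y Z\<^sup>2 - (X\<^sup>3 + a2 X\<^sup>2 Z + a4 X Z\<^sup>2 + a6 Z\<^sup>3)\<close>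
  and of its partial derivatives in \<open>X\<close>, \<open>Y\<close>, \<open>Z\<close>.\<close>

definition singular_points :: "'b weierstrass \<Rightarrow> 'b triple set set" where
  "singular_points W = {ring_proj (X, Y, Z) | X Y Z.
     X \<in> carrier k \<and> Y \<in> carrier k \<and> Z \<in> carrier k \<and> (X, Y, Z) \<noteq> (\<zero>, \<zero>, \<zero>) \<and>
     (Y \<otimes> Y \<otimes> Z \<oplus> a1 W \<otimes> X \<otimes> Y \<otimes> Z \<oplus> a3 W \<otimes> Y \<otimes> Z \<otimes> Z)
       \<ominus> (X \<otimes> X \<otimes> X \<oplus> a2 W \<otimes> X \<otimes> X \<otimes> Z \<oplus> a4 W \<otimes> X \<otimes> Z \<otimes> Z \<oplus> a6 W \<otimes> Z \<otimes> Z \<otimes> Z) = \<zero> \<and>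
     a1 W \<otimes> Y \<otimes> Z
       \<ominus> (add_pow k (3::nat) (X \<otimes> X) \<oplus> add_pow k (2::nat) (a2 W \<otimes> X \<otimes> Z) \<oplus> a4 W \<otimes> Z \<otimes> Z) = \<zero> \<and>
     add_pow k (2::nat) (Y \<otimes> Z) \<oplus> a1 W \<otimes> X \<otimes> Z \<oplus> a3 W \<otimes> Z \<otimes> Z = \<zero> \<and>
     (Y \<otimes> Y \<oplus> a1 W \<otimes> X \<otimes> Y \<oplus> add_pow k (2::nat) (a3 W \<otimes> Y \<otimes> Z))
       \<ominus> (a2 W \<otimes> X \<otimes> X \<oplus> add_pow k (2::nat) (a4 W \<otimes> X \<otimes> Z)
            \<oplus> add_pow k (3::nat) (a6 W \<otimes> Z \<otimes> Z)) = \<zero>}"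

end

definition reduced_weierstrass ::
  "('a::field \<Rightarrow> ereal) \<Rightarrow> 'a weierstrass \<Rightarrow> 'a set weierstrass" where
  "reduced_weierstrass v W = map_weierstrass (residue v) W"

definition reduces_to ::
  "('a::field \<Rightarrow> ereal) \<Rightarrow> 'a triple set \<Rightarrow> 'a set triple set \<Rightarrow> bool" where
  "reduces_to v P Q \<longleftrightarrow>
     (\<exists>X Y Z. (X, Y, Z) \<in> P \<and> 0 \<le> v X \<and> 0 \<le> v Y \<and> 0 \<le> v Z \<and> (v X = 0 \<or> v Y = 0 \<or> v Z = 0) \<and>
        Q = ring_proj (residue_field v) (residue v X, residue v Y, residue v Z))"


section \<open>The function field\<close>

text \<open>An element of the function field of \<open>W\<close> is the set of all fractions \<open>F/G\<close> of forms of
  equal degree, with \<open>G\<close> not identically zero on the curve, that represent it.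
  \<open>rat_fun W p q\<close> is the element \<open>p(x,y) / q(x,y)\<close>, where \<open>p\<close> and \<open>q\<close> are polynomial
  functions of the affine coordinates \<open>x = X/Z\<close>, \<open>y = Y/Z\<close> and \<open>q\<close> does not vanish
  identically on the curve.\<close>

type_synonym 'a fractions = "(('a triple \<Rightarrow> 'a) \<times> ('a triple \<Rightarrow> 'a)) set"

definition rat_fun ::
  "'a::alg_closed_field weierstrass \<Rightarrow> ('a \<Rightarrow> 'a \<Rightarrow> 'a) \<Rightarrow> ('a \<Rightarrow> 'a \<Rightarrow> 'a) \<Rightarrow> 'a fractions" where
  "rat_fun W p q = {(F, G).
     (\<exists>n. form n F \<and> form n G) \<and> (\<exists>t. proj t \<in> curve W \<and> G t \<noteq> 0) \<and>
     (\<forall>x y. proj (x, y, 1) \<in> curve W \<longrightarrow> p x y * G (x, y, 1) = q x y * F (x, y, 1))}"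

text \<open>The element \<open>h\<close> of the function field is regular at the point \<open>P\<close>, with value
  \<open>c\<close> there.\<close>

definition has_value ::
  "'a::alg_closed_field fractions \<Rightarrow> 'a triple set \<Rightarrow> 'a \<Rightarrow> bool" where
  "has_value h P c \<longleftrightarrow> (\<exists>F G t. (F, G) \<in> h \<and> t \<in> P \<and> G t \<noteq> 0 \<and> c = F t / G t)"

text \<open>\<open>\<phi>\<close> is a morphism to the projective plane that extends \<open>[f : g : 1]\<close>. Only its
  values on the curve matter.\<close>

definition induced_morphism ::
  "'a::alg_closed_field weierstrass \<Rightarrow> 'a fractions \<Rightarrow> 'a fractions \<Rightarrow>
     ('a triple set \<Rightarrow> 'a triple set) \<Rightarrow> bool" where
  "induced_morphism W f g \<phi> \<longleftrightarrow> morphism (curve W) proj_plane \<phi> \<and>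
     (\<forall>P\<in>curve W. \<forall>c d. has_value f P c \<and> has_value g P d \<longrightarrow> \<phi> P = proj (c, d, 1))"

end

theory Submission
  imports Defs
begin

text \<open>Put \<open>u = y - a' (x - b)\<close> and \<open>w = y + a' (x - b)\<close>, so that the
  equation of the curve becomes \<open>u w = x\<^sup>3\<close>. Hence \<open>f = w / x\<close> and \<open>g = u / x\<close>, and
  \<open>[f : g : 1] = [w : u : x]\<close> is the restriction of a linear automorphism of the projective plane,
  since the discriminant \<open>- 16 a\<^sup>2 b\<^sup>3 (4 a + 27 b)\<close> is nonzero only if
  \<open>2\<close>, \<open>a\<close> and \<open>b\<close> are. It maps the curve onto
  \<open>z\<^sup>3 = x y z / b + x y (y - x) / (2 a' b)\<close>. A form that vanishes on such a cubic is
  divisible by its equation: the remainder of the division has degree at most 2 in \<open>z\<close>, but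
  it has three distinct zeros wherever the discriminant in \<open>z\<close> does not vanish. The same
  divisibility shows that no point of the cubic is isolated, which makes the extension of
  \<open>[f : g : 1]\<close> to a morphism unique.\<close>

section \<open>Forms\<close>

lemma infinite_UNIV_alg_closed: "infinite (UNIV :: 'a::alg_closed_field set)"
proof
  assume fin: "finite (UNIV :: 'a set)"
  \<comment> \<open>Over a finite field this product vanishes at every element, so
    \<open>p + 1\<close> would be a nonconstant polynomial without a root.\<close>
  define p :: "'a poly" where "p = (\<Prod>a\<in>UNIV. [:- a, 1:])"
  have deg: "degree p = card (UNIV :: 'a set)"
    unfolding p_def by (subst degree_prod_sum_eq) auto
  have "card (UNIV :: 'a set) > 0"
    using fin by (simp add: finite_UNIV_card_ge_0)
  then have "degree (p + 1) > 0"
    by (subst degree_add_eq_left) (simp_all add: deg)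
  then obtain x where "poly (p + 1) x = 0"
    using alg_closed_imp_poly_has_root by blast
  moreover have "poly p x = 0"
    unfolding p_def poly_prod using fin by (auto intro!: prod_zero bexI[of _ x])
  ultimately show False
    by simp
qed

lemma poly_eq_0_cofinite:
  fixes p :: "'a::alg_closed_field poly"
  assumes "finite A" and "\<And>x. x \<notin> A \<Longrightarrow> poly p x = 0"
  shows "p = 0"
proof (rule ccontr)
  assume "p \<noteq> 0"
  then have "finite ({x. poly p x = 0} \<union> A)"
    using assms(1) poly_roots_finite by blast
  moreover have "{x. poly p x = 0} \<union> A = UNIV"
    using assms(2) by blast
  ultimately show False
    using infinite_UNIV_alg_closed[where 'a = 'a] by simp
qed

section \<open>Coordinate triples and projective points\<close>

definition scale :: "'a::field \<Rightarrow> 'a triple \<Rightarrow> 'a triple" where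
  "scale c = (\<lambda>(x, y, z). (c * x, c * y, c * z))"

lemma scale_simp [simp]: "scale c (x, y, z) = (c * x, c * y, c * z)"
  by (simp add: scale_def)

lemma scale_scale [simp]: "scale c (scale d t) = scale (c * d) t"
  by (cases t) (simp add: mult.assoc)

lemma scale_1 [simp]: "scale 1 t = t"
  by (cases t) simp

lemma scale_eq_0_iff [simp]: "scale c t = (0, 0, 0) \<longleftrightarrow> c = 0 \<or> t = (0, 0, 0)"
  by (cases t) auto

lemma proj_scale_image: "proj t = {scale c t | c. c \<noteq> 0}"
  by (cases t) (auto simp: proj_def)

lemma self_in_proj [simp]: "t \<in> proj t"
  unfolding proj_scale_image using scale_1 by (metis (mono_tags, lifting) mem_Collect_eq zero_neq_one)

lemma proj_eq_iff: "proj t = proj u \<longleftrightarrow> (\<exists>c. c \<noteq> 0 \<and> t = scale c u)"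
proof
  assume "proj t = proj u"
  then have "t \<in> proj u"
    using self_in_proj by blast
  then show "\<exists>c. c \<noteq> 0 \<and> t = scale c u"
    by (auto simp: proj_scale_image)
next
  assume "\<exists>c. c \<noteq> 0 \<and> t = scale c u"
  then obtain c where c: "c \<noteq> 0" "t = scale c u"
    by blast
  have "scale d u \<in> proj t" if "d \<noteq> 0" for d
    unfolding proj_scale_image using c that
    by (auto intro!: exI[of _ "d / c"])
  moreover have "scale d t \<in> proj u" if "d \<noteq> 0" for d
    unfolding proj_scale_image using c that by auto
  ultimately show "proj t = proj u"
    unfolding proj_scale_image[of t] proj_scale_image[of u] by (auto simp: proj_scale_image)
qed

lemma in_proj_iff: "t \<in> proj u \<longleftrightarrow> proj t = proj u"
  by (auto simp: proj_eq_iff) (auto simp: proj_scale_image)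

section \<open>Homogeneity and closure properties of forms\<close>

lemma form_scale: "form n F \<Longrightarrow> F (scale c t) = c ^ n * F t"
  by (induction rule: form.induct; cases t) (auto simp: power_add algebra_simps)

lemma form_cmult: "form n F \<Longrightarrow> form n (\<lambda>t. c * F t)"
  using form_mult[OF form_const[of c]] by force

lemma form_uminus: "form n F \<Longrightarrow> form n (\<lambda>t. - F t)"
  using form_cmult[of n F "- 1"] by simp

lemma form_diff: "form n F \<Longrightarrow> form n G \<Longrightarrow> form n (\<lambda>t. F t - G t)"
  using form_add[OF _ form_uminus] by force

lemma form_power: "form n F \<Longrightarrow> form (k * n) (\<lambda>t. F t ^ k)"
proof (induction k)
  case 0
  then show ?case using form_const[of 1] by simp
next
  case (Suc k)
  then show ?case using form_mult[of n F] by simp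
qed

lemma form_zero: "form n (\<lambda>_. 0)"
proof -
  \<comment> \<open>\<open>form_const\<close> yields zero in degree 0 only; in degree
    \<open>n\<close> it arises as 0 times the \<open>n\<close>-th power of a coordinate.\<close>
  have "form (n * 1) (\<lambda>t. (case t of (x, y, z) \<Rightarrow> x) ^ n)"
    by (rule form_power) (rule form_X)
  from form_cmult[OF this, of 0] show ?thesis
    by simp
qed

lemma form_compose:
  assumes "form n F" and "form m F\<^sub>0" and "form m F\<^sub>1" and "form m F\<^sub>2"
  shows "form (n * m) (\<lambda>t. F (F\<^sub>0 t, F\<^sub>1 t, F\<^sub>2 t))"
  using assms(1)
proof (induction rule: form.induct)
  case (form_add n F G)
  then show ?case by (intro form.form_add)
next
  case (form_mult k F n G)
  then show ?case unfolding add_mult_distrib by (intro form.form_mult)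
qed (use assms form_const in \<open>simp_all\<close>)

text \<open>Moves identities between forms, which are mere functions, into the integral domain of
  polynomials in one variable.\<close>

lemma form_on_line:
  assumes "form n F"
  shows "\<exists>p. \<forall>s. F (x + s * x', y + s * y', z + s * z') = poly p s"
  using assms
proof (induction rule: form.induct)
  case form_X
  show ?case by (intro exI[of _ "[:x, x':]"]) simp
next
  case form_Y
  show ?case by (intro exI[of _ "[:y, y':]"]) simp
next
  case form_Z
  show ?case by (intro exI[of _ "[:z, z':]"]) simp
next
  case (form_const c)
  show ?case by (intro exI[of _ "[:c:]"]) simp
next
  case (form_add n F G)
  then show ?case by (metis poly_add)
next
  case (form_mult m F n G)
  then show ?case by (metis poly_mult)
qed

text \<open>On the line with parameter 0 at \<open>t\<close> and 1 at \<open>t\<^sub>0\<close>, the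
  two forms become polynomials with product zero. The one coming from \<open>D\<close> is nonzero
  because of its value at 1, so the other one is zero.\<close>

lemma form_mult_eq_0_cancel:
  assumes "form m D" and "form n F" and "\<And>t. D t * F t = 0" and "D t\<^sub>0 \<noteq> 0"
  shows "F t = 0"
proof -
  obtain x y z where t: "t = (x, y, z)"
    by (cases t)
  obtain x' y' z' where t0: "t\<^sub>0 = (x', y', z')"
    by (cases t\<^sub>0)
  let ?l = "\<lambda>s. (x + s * (x' - x), y + s * (y' - y), z + s * (z' - z))"
  obtain p where p: "\<And>s. D (?l s) = poly p s"
    using form_on_line[OF assms(1)] by blast
  obtain q where q: "\<And>s. F (?l s) = poly q s"
    using form_on_line[OF assms(2)] by blast
  have "poly (p * q) s = 0" for s
    using assms(3)[of "?l s"] by (simp add: p q)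
  then have "p * q = 0"
    by (intro poly_eq_0_cofinite[of "{}"]) auto
  moreover have "p \<noteq> 0"
    using p[of 1] assms(4) by (auto simp: t0)
  ultimately show ?thesis
    using q[of 0] by (simp add: t)
qed

lemma proj_in_zero_locus:
  assumes "form n H"
  shows "proj t \<in> zero_locus H \<longleftrightarrow> t \<noteq> (0, 0, 0) \<and> H t = 0"
proof
  assume "proj t \<in> zero_locus H"
  then obtain u where u: "proj t = proj u" "u \<noteq> (0, 0, 0)" "H u = 0"
    by (auto simp: zero_locus_def)
  then obtain c where "c \<noteq> 0" "t = scale c u"
    by (auto simp: proj_eq_iff)
  with u show "t \<noteq> (0, 0, 0) \<and> H t = 0"
    by (simp add: form_scale[OF assms])
next
  assume "t \<noteq> (0, 0, 0) \<and> H t = 0"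
  then show "proj t \<in> zero_locus H"
    unfolding zero_locus_def by blast
qed

section \<open>Plane cubics whose equation is a depressed cubic in the last coordinate\<close>

text \<open>Degrees are integers, so that the quotient by a cubic form has degree \<open>n - 3\<close> also
  when \<open>n < 3\<close>.\<close>

definition gform :: "int \<Rightarrow> ('a::alg_closed_field triple \<Rightarrow> 'a) \<Rightarrow> bool" where
  "gform n F \<longleftrightarrow> (0 \<le> n \<and> form (nat n) F) \<or> F = (\<lambda>_. 0)"

lemma gform_form: "form n F \<Longrightarrow> gform (int n) F"
  by (simp add: gform_def)

lemma gform_imp_form: "gform n F \<Longrightarrow> \<exists>m. form m F"
  using form_zero by (auto simp: gform_def)

lemma gform_zero: "gform n (\<lambda>_. 0)"
  by (simp add: gform_def)

lemma gform_add: "gform n F \<Longrightarrow> gform n G \<Longrightarrow> gform n (\<lambda>t. F t + G t)"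
  by (auto simp: gform_def intro: form_add)

lemma gform_mult: "gform m F \<Longrightarrow> gform n G \<Longrightarrow> gform (m + n) (\<lambda>t. F t * G t)"
  by (auto simp: gform_def nat_add_distrib intro: form_mult)

text \<open>Coefficients in \<open>x\<close> and \<open>y\<close> alone remain functions of triples,
  so that the closure rules for forms apply to them directly.\<close>

definition z_free :: "('a triple \<Rightarrow> 'a::alg_closed_field) \<Rightarrow> bool" where
  "z_free A \<longleftrightarrow> (\<forall>x y z. A (x, y, z) = A (x, y, 0))"

lemma z_freeD: "z_free A \<Longrightarrow> A (x, y, z) = A (x, y, z')"
  unfolding z_free_def by metis

section \<open>Division with remainder by a cubic that is monic in the last coordinate\<close>

locale depressed_cubic =
  fixes p q :: "'a::alg_closed_field triple \<Rightarrow> 'a"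
  assumes form_p: "form 2 p" and form_q: "form 3 q"
    and zf_p: "z_free p" and zf_q: "z_free q"
begin

definition T :: "'a triple \<Rightarrow> 'a" where
  "T = (\<lambda>(x, y, z). z ^ 3 - p (x, y, z) * z - q (x, y, z))"

lemma T_simp: "T (x, y, z) = z ^ 3 - p (x, y, 0) * z - q (x, y, 0)"
  using z_freeD[OF zf_p, of x y z 0] z_freeD[OF zf_q, of x y z 0] by (simp add: T_def)

lemma form_T: "form 3 T"
proof -
  have "form (3 * 1) (\<lambda>t. (case t of (x, y, z) \<Rightarrow> z) ^ 3)"
    by (rule form_power) (rule form_Z)
  moreover have "form (2 + 1) (\<lambda>t. p t * (case t of (x, y, z) \<Rightarrow> z))"
    by (rule form_mult[OF form_p form_Z])
  ultimately have "form 3 (\<lambda>t. (case t of (x, y, z) \<Rightarrow> z) ^ 3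
      - p t * (case t of (x, y, z) \<Rightarrow> z) - q t)"
    by (intro form_diff form_q) simp_all
  then show ?thesis
    by (simp add: T_def case_prod_beta')
qed

text \<open>Since \<open>T\<close> is monic in \<open>z\<close>, division by it needs no
  denominators. The degrees are recorded so that the quotient and the coefficients of the remainder
  are again forms.\<close>

definition divisible_with_remainder :: "int \<Rightarrow> ('a triple \<Rightarrow> 'a) \<Rightarrow> bool" where
  "divisible_with_remainder n F \<longleftrightarrow> (\<exists>G A B C. gform (n - 3) G \<and>
     gform n A \<and> gform (n - 1) B \<and> gform (n - 2) C \<and> z_free A \<and> z_free B \<and> z_free C \<and>
     (\<forall>x y z. F (x, y, z) = T (x, y, z) * G (x, y, z)
        + (A (x, y, z) + B (x, y, z) * z + C (x, y, z) * z ^ 2)))"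

lemma divisible_with_remainderI:
  assumes "gform (n - 3) G" "gform n A" "gform (n - 1) B" "gform (n - 2) C"
    "z_free A" "z_free B" "z_free C"
    "\<And>x y z. F (x, y, z) = T (x, y, z) * G (x, y, z)
        + (A (x, y, z) + B (x, y, z) * z + C (x, y, z) * z ^ 2)"
  shows "divisible_with_remainder n F"
  using assms unfolding divisible_with_remainder_def by blast

lemma dwr_add:
  assumes "divisible_with_remainder n F" and "divisible_with_remainder n G"
  shows "divisible_with_remainder n (\<lambda>t. F t + G t)"
proof -
  obtain F' A B C where F: "gform (n - 3) F'" "gform n A" "gform (n - 1) B" "gform (n - 2) C"
    "z_free A" "z_free B" "z_free C"
    "\<And>x y z. F (x, y, z) = T (x, y, z) * F' (x, y, z)
        + (A (x, y, z) + B (x, y, z) * z + C (x, y, z) * z ^ 2)"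
    using assms(1) unfolding divisible_with_remainder_def by blast
  obtain G' A' B' C' where G: "gform (n - 3) G'" "gform n A'" "gform (n - 1) B'" "gform (n - 2) C'"
    "z_free A'" "z_free B'" "z_free C'"
    "\<And>x y z. G (x, y, z) = T (x, y, z) * G' (x, y, z)
        + (A' (x, y, z) + B' (x, y, z) * z + C' (x, y, z) * z ^ 2)"
    using assms(2) unfolding divisible_with_remainder_def by blast
  show ?thesis
  proof (rule divisible_with_remainderI)
    show "z_free (\<lambda>t. A t + A' t)" "z_free (\<lambda>t. B t + B' t)" "z_free (\<lambda>t. C t + C' t)"
      using F(5-7) G(5-7) unfolding z_free_def by metis+
    show "gform (n - 3) (\<lambda>t. F' t + G' t)" "gform n (\<lambda>t. A t + A' t)"
      "gform (n - 1) (\<lambda>t. B t + B' t)" "gform (n - 2) (\<lambda>t. C t + C' t)"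
      using F(1-4) G(1-4) by (auto intro: gform_add)
  qed (simp add: F(8) G(8) algebra_simps)
qed

lemma dwr_z_free_mult:
  assumes "gform m D" and "z_free D" and "divisible_with_remainder n F"
  shows "divisible_with_remainder (m + n) (\<lambda>t. D t * F t)"
proof -
  obtain G A B C where F: "gform (n - 3) G" "gform n A" "gform (n - 1) B" "gform (n - 2) C"
    "z_free A" "z_free B" "z_free C"
    "\<And>x y z. F (x, y, z) = T (x, y, z) * G (x, y, z)
        + (A (x, y, z) + B (x, y, z) * z + C (x, y, z) * z ^ 2)"
    using assms(3) unfolding divisible_with_remainder_def by blast
  show ?thesis
  proof (rule divisible_with_remainderI)
    show "z_free (\<lambda>t. D t * A t)" "z_free (\<lambda>t. D t * B t)" "z_free (\<lambda>t. D t * C t)"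
      using F(5-7) assms(2) unfolding z_free_def by metis+
    show "gform (m + n - 3) (\<lambda>t. D t * G t)" "gform (m + n) (\<lambda>t. D t * A t)"
      "gform (m + n - 1) (\<lambda>t. D t * B t)" "gform (m + n - 2) (\<lambda>t. D t * C t)"
      using gform_mult[OF assms(1) F(1)] gform_mult[OF assms(1) F(2)]
        gform_mult[OF assms(1) F(3)] gform_mult[OF assms(1) F(4)]
      by (simp_all add: algebra_simps)
  qed (simp add: F(8) algebra_simps)
qed

text \<open>Multiplication by \<open>z\<close> creates the term \<open>C z^3\<close>; replacing
  \<open>z^3\<close> by \<open>T + p z + q\<close> moves \<open>C\<close> into the quotient and
  \<open>p C\<close>, \<open>q C\<close> into the remainder.\<close>

lemma dwr_z_mult:
  assumes "divisible_with_remainder n F"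
  shows "divisible_with_remainder (n + 1) (\<lambda>t. snd (snd t) * F t)"
proof -
  obtain G A B C where F: "gform (n - 3) G" "gform n A" "gform (n - 1) B" "gform (n - 2) C"
    "z_free A" "z_free B" "z_free C"
    "\<And>x y z. F (x, y, z) = T (x, y, z) * G (x, y, z)
        + (A (x, y, z) + B (x, y, z) * z + C (x, y, z) * z ^ 2)"
    using assms(1) unfolding divisible_with_remainder_def by blast
  have Z: "gform 1 (\<lambda>t. snd (snd t))"
    using gform_form[OF form_Z] by (simp add: case_prod_beta')
  have p: "gform 2 p" and q: "gform 3 q"
    using gform_form[OF form_p] gform_form[OF form_q] by simp_all
  show ?thesis
  proof (rule divisible_with_remainderI)
    show "gform (n + 1 - 3) (\<lambda>t. snd (snd t) * G t + C t)"
      by (rule gform_add) (use gform_mult[OF Z F(1)] F(4) in simp_all)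
    show "gform (n + 1) (\<lambda>t. q t * C t)"
      using gform_mult[OF q F(4)] by (simp add: algebra_simps)
    show "gform (n + 1 - 1) (\<lambda>t. A t + p t * C t)"
      by (rule gform_add) (use gform_mult[OF p F(4)] F(2) in simp_all)
    show "gform (n + 1 - 2) B"
      using F(3) by (simp add: algebra_simps)
    show "z_free (\<lambda>t. q t * C t)" "z_free (\<lambda>t. A t + p t * C t)"
      using F(5,7) zf_p zf_q unfolding z_free_def by metis+
    show "z_free B"
      by (rule F)
  qed (simp add: F(8) T_def algebra_simps power2_eq_square power3_eq_cube)
qed

text \<open>Multiplying an arbitrary dividend by \<open>D\<close> makes the product case of the
  induction a composition of two steps, so two remainders never have to be multiplied.\<close>

lemma dwr_form_mult:
  assumes "form m D" and "divisible_with_remainder n F"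
  shows "divisible_with_remainder (int m + n) (\<lambda>t. D t * F t)"
  using assms
proof (induction arbitrary: n F rule: form.induct)
  case form_X
  then show ?case
    using gform_form[OF form.form_X] by (intro dwr_z_free_mult) (auto simp: z_free_def)
next
  case form_Y
  then show ?case
    using gform_form[OF form.form_Y] by (intro dwr_z_free_mult) (auto simp: z_free_def)
next
  case form_Z
  then show ?case
    using dwr_z_mult[OF form_Z] by (simp add: case_prod_beta' add.commute)
next
  case (form_const c)
  then show ?case
    using gform_form[OF form.form_const] by (intro dwr_z_free_mult) (auto simp: z_free_def)
next
  case (form_add k D E)
  then show ?case
    using dwr_add by (simp add: distrib_right)
next
  case (form_mult k D l E)
  then show ?case
    using form_mult.IH(1)[OF form_mult.IH(2)[OF form_mult.prems]] by (simp add: mult.assoc add.assoc)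
qed

lemma dwr_form:
  assumes "form n F"
  shows "divisible_with_remainder n F"
proof -
  \<comment> \<open>Every form is a multiple of the constant 1, which is its own remainder.\<close>
  have "divisible_with_remainder 0 (\<lambda>_. 1)"
    by (rule divisible_with_remainderI[of 0 "\<lambda>_. 0" "\<lambda>_. 1" "\<lambda>_. 0" "\<lambda>_. 0"])
      (auto simp: gform_zero z_free_def gform_def form_const)
  from dwr_form_mult[OF assms this] show ?thesis
    by simp
qed

end

section \<open>Distinct roots and the discriminant of a depressed cubic\<close>

lemma depressed_cubic_roots:
  fixes p q :: "'a::alg_closed_field"
  assumes "4 * p ^ 3 - 27 * q ^ 2 \<noteq> 0"
  obtains r s t where "r \<noteq> s" "r \<noteq> t" "s \<noteq> t"
    "r ^ 3 - p * r - q = 0" "s ^ 3 - p * s - q = 0" "t ^ 3 - p * t - q = 0"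
proof -
  obtain r where "poly [:- q, - p, 0, 1:] r = 0"
    using alg_closed_imp_poly_has_root[of "[:- q, - p, 0, 1:]"] by auto
  then have r: "q = r ^ 3 - p * r"
    by (simp add: algebra_simps power3_eq_cube)
  \<comment> \<open>This quadratic is the quotient of the cubic by its linear factor at
    \<open>r\<close>. The third root is \<open>- r - s\<close>, since the roots sum to 0.\<close>
  obtain s where "poly [:r ^ 2 - p, r, 1:] s = 0"
    using alg_closed_imp_poly_has_root[of "[:r ^ 2 - p, r, 1:]"] by auto
  then have s: "p = r ^ 2 + r * s + s ^ 2"
    by (simp add: algebra_simps power2_eq_square)
  have q: "q = - (r * s * (r + s))"
    unfolding r s by (simp add: algebra_simps power2_eq_square power3_eq_cube)
  \<comment> \<open>The discriminant is the square of the product of the differences of the roots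
    \<open>r\<close>, \<open>s\<close> and \<open>- r - s\<close>.\<close>
  have "4 * p ^ 3 - 27 * q ^ 2 = ((r - s) * (2 * r + s) * (r + 2 * s)) ^ 2"
    unfolding q s by (simp add: algebra_simps power2_eq_square power3_eq_cube)
  with assms have distinct: "r - s \<noteq> 0" "2 * r + s \<noteq> 0" "r + 2 * s \<noteq> 0"
    by (metis mult_zero_left mult_zero_right zero_power2)+
  show ?thesis
  proof (rule that[of r s "- r - s"])
    show "r \<noteq> s" "r \<noteq> - r - s" "s \<noteq> - r - s"
      using distinct by (auto simp: algebra_simps eq_neg_iff_add_eq_0)
    show "r ^ 3 - p * r - q = 0"
      by (simp add: r)
    show "s ^ 3 - p * s - q = 0" "(- r - s) ^ 3 - p * (- r - s) - q = 0"
      unfolding q s by (simp_all add: algebra_simps power2_eq_square power3_eq_cube)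
  qed
qed

lemma quadratic_three_roots:
  fixes a b c :: "'a::field"
  assumes "r \<noteq> s" "r \<noteq> t" "s \<noteq> t"
    and "a + b * r + c * r ^ 2 = 0" "a + b * s + c * s ^ 2 = 0" "a + b * t + c * t ^ 2 = 0"
  shows "a = 0 \<and> b = 0 \<and> c = 0"
proof -
  have "(u - w) * (b + c * (u + w)) = (a + b * u + c * u ^ 2) - (a + b * w + c * w ^ 2)" for u w
    by (simp add: algebra_simps power2_eq_square)
  from this[of r s] this[of r t] have "(r - s) * (b + c * (r + s)) = 0" "(r - t) * (b + c * (r + t)) = 0"
    unfolding assms(4-6) by simp_all
  then have bc: "b + c * (r + s) = 0" "b + c * (r + t) = 0"
    using assms(1,2) by simp_all
  have "c * (s - t) = (b + c * (r + s)) - (b + c * (r + t))"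
    by (simp add: algebra_simps)
  then have "c * (s - t) = 0"
    unfolding bc by simp
  with assms(3) have "c = 0" by simp
  with bc assms(4) show ?thesis by simp
qed

section \<open>The ideal of the cubic, and the absence of isolated points\<close>

context depressed_cubic
begin

text \<open>Where the discriminant \<open>D\<close> is nonzero, the remainder of \<open>F\<close>
  modulo \<open>T\<close> has three distinct zeros in \<open>z\<close>, so its coefficients vanish.
  Their products with \<open>D\<close> therefore vanish everywhere, and \<open>D\<close>, which is
  not the zero form, can be cancelled.\<close>

lemma cut_out_by_T:
  assumes "4 * p t\<^sub>0 ^ 3 - 27 * q t\<^sub>0 ^ 2 \<noteq> 0"
  shows "cut_out_by (zero_locus T) T"
  unfolding cut_out_by_def
proof (intro conjI allI impI)
  fix n F
  assume "form n F \<and> (\<forall>t. proj t \<in> zero_locus T \<longrightarrow> F t = 0)"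
  then have F: "form n F" and van: "\<And>t. t \<noteq> (0, 0, 0) \<Longrightarrow> T t = 0 \<Longrightarrow> F t = 0"
    by (auto simp: proj_in_zero_locus[OF form_T])
  obtain G A B C where G: "gform (int n - 3) G" and A: "gform n A" and B: "gform (int n - 1) B"
    and C: "gform (int n - 2) C" and zf: "z_free A" "z_free B" "z_free C"
    and eq: "\<And>x y z. F (x, y, z) = T (x, y, z) * G (x, y, z)
        + (A (x, y, z) + B (x, y, z) * z + C (x, y, z) * z ^ 2)"
    using dwr_form[OF F] unfolding divisible_with_remainder_def by blast
  define D where "D t = 4 * p t ^ 3 - 27 * q t ^ 2" for t
  have D: "form 6 D"
    unfolding D_def using form_power[OF form_p, of 3] form_power[OF form_q, of 2]
    by (intro form_diff form_cmult) simp_all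
  have rem0: "A (x, y, z) = 0 \<and> B (x, y, z) = 0 \<and> C (x, y, z) = 0" if "D (x, y, z) \<noteq> 0" for x y z
  proof -
    have eqs: "E (x, y, z') = E (x, y, z)" if "z_free E" for E :: "'a triple \<Rightarrow> 'a" and z'
      using z_freeD[OF that] .
    \<comment> \<open>Ensures that \<open>(x, y, u)\<close> is a projective point for every root
      \<open>u\<close>, including 0. At \<open>x = y = 0\<close> the forms \<open>p\<close> and
      \<open>q\<close> of positive degree vanish, and \<open>D\<close> with them.\<close>
    have xy: "(x, y) \<noteq> (0, 0)"
    proof
      assume xy: "(x, y) = (0, 0)"
      have "p (x, y, z) = p (scale 0 (1, 1, 1))" "q (x, y, z) = q (scale 0 (1, 1, 1))"
        using xy z_freeD[OF zf_p, of 0 0 z 0] z_freeD[OF zf_q, of 0 0 z 0] by simp_all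
      then have "D (x, y, z) = 0"
        unfolding D_def form_scale[OF form_p] form_scale[OF form_q] by simp
      then show False using that by simp
    qed
    obtain r s t where rst: "r \<noteq> s" "r \<noteq> t" "s \<noteq> t"
      "r ^ 3 - p (x, y, z) * r - q (x, y, z) = 0" "s ^ 3 - p (x, y, z) * s - q (x, y, z) = 0"
      "t ^ 3 - p (x, y, z) * t - q (x, y, z) = 0"
      using depressed_cubic_roots \<open>D (x, y, z) \<noteq> 0\<close> unfolding D_def by metis
    have "A (x, y, z) + B (x, y, z) * u + C (x, y, z) * u ^ 2 = 0"
      if "u ^ 3 - p (x, y, z) * u - q (x, y, z) = 0" for u
    proof -
      have "T (x, y, u) = 0"
        using that eqs[OF zf_p, of u] eqs[OF zf_q, of u] by (simp add: T_def)
      then have "F (x, y, u) = 0"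
        using van xy by auto
      then show ?thesis
        using eq[of x y u] \<open>T (x, y, u) = 0\<close>
          eqs[OF zf(1), of u] eqs[OF zf(2), of u] eqs[OF zf(3), of u] by simp
    qed
    with rst show ?thesis
      by (intro quadratic_three_roots[of r s t]) simp_all
  qed
  have rem: "E t = 0" if E: "gform k E" "\<And>x y z. D (x, y, z) \<noteq> 0 \<Longrightarrow> E (x, y, z) = 0" for k E t
  proof -
    obtain m where "form m E"
      using gform_imp_form[OF E(1)] by blast
    moreover have "D t * E t = 0" for t
      using E(2) by (cases t) auto
    ultimately show ?thesis
      using D assms unfolding D_def[symmetric] by (intro form_mult_eq_0_cancel[of 6 D m E]) auto
  qed
  have "A t = 0" "B t = 0" "C t = 0" for t
    using rem[OF A] rem[OF B] rem[OF C] rem0 by blast+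
  then have "F = (\<lambda>t. T t * G t)"
    using eq by auto
  then show "\<exists>m G. form m G \<and> F = (\<lambda>t. T t * G t)"
    using gform_imp_form[OF G] by blast
qed simp

text \<open>No point of the curve on the line \<open>z = 0\<close> is isolated: the quotient of \<open>z Q\<close>
  by \<open>T\<close> vanishes on that line, where \<open>T\<close> restricts to the nonzero form \<open>- q\<close>.\<close>

lemma vanishes_on_cubic:
  assumes "4 * p t\<^sub>0 ^ 3 - 27 * q t\<^sub>0 ^ 2 \<noteq> 0" and "q t\<^sub>1 \<noteq> 0" and "form n Q"
    and off: "\<And>x y z. T (x, y, z) = 0 \<Longrightarrow> z \<noteq> 0 \<Longrightarrow> Q (x, y, z) = 0"
    and "T t = 0"
  shows "Q t = 0"
proof -
  have "form (1 + n) (\<lambda>t. (case t of (x, y, z) \<Rightarrow> z) * Q t)"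
    by (rule form_mult[OF form_Z assms(3)])
  moreover have "\<forall>t. proj t \<in> zero_locus T \<longrightarrow> (case t of (x, y, z) \<Rightarrow> z) * Q t = 0"
    using off by (auto simp: proj_in_zero_locus[OF form_T])
  ultimately obtain m G where G: "form m G"
    and eq: "(\<lambda>t. (case t of (x, y, z) \<Rightarrow> z) * Q t) = (\<lambda>t. T t * G t)"
    using cut_out_by_T[OF assms(1)] unfolding cut_out_by_def by blast
  have zQ: "z * Q (x, y, z) = T (x, y, z) * G (x, y, z)" for x y z
    using fun_cong[OF eq, of "(x, y, z)"] by simp
  \<comment> \<open>The restriction of \<open>G\<close> to \<open>z = 0\<close>, extended constantly
    in \<open>z\<close>, is again a form, so that \<open>q\<close> can be cancelled from its product
    with it.\<close>
  have G0: "form (m * 1) (\<lambda>t. G ((case t of (x, y, z) \<Rightarrow> x), (case t of (x, y, z) \<Rightarrow> y), 0))"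
    by (rule form_compose[OF G form_X form_Y form_zero])
  have "q u * G ((case u of (x, y, z) \<Rightarrow> x), (case u of (x, y, z) \<Rightarrow> y), 0) = 0" for u
  proof (cases u)
    case (fields x y z)
    have "q (x, y, z) = q (x, y, 0)"
      using zf_q unfolding z_free_def by blast
    then show ?thesis
      using zQ[of 0 x y] fields by (simp add: T_simp)
  qed
  from form_mult_eq_0_cancel[OF form_q G0 this assms(2)]
  have G_line: "G (x, y, 0) = 0" for x y
    by force
  obtain x y z where t: "t = (x, y, z)"
    by (cases t)
  show ?thesis
  proof (cases "z = 0")
    case True
    obtain P where P: "\<And>s. Q (x, y, s) = poly P s"
      using form_on_line[OF assms(3), of x 0 y 0 0 1] by auto
    obtain R where R: "\<And>s. G (x, y, s) = poly R s"
      using form_on_line[OF G, of x 0 y 0 0 1] by auto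
    obtain S where S: "\<And>s. T (x, y, s) = poly S s"
      using form_on_line[OF form_T, of x 0 y 0 0 1] by auto
    have "poly R 0 = 0" "poly S 0 = 0"
      using R[of 0] S[of 0] G_line \<open>T t = 0\<close> t True by simp_all
    then obtain R' S' where RS: "R = [:0, 1:] * R'" "S = [:0, 1:] * S'"
      using poly_eq_0_iff_dvd[of R 0] poly_eq_0_iff_dvd[of S 0] by (auto elim!: dvdE)
    \<comment> \<open>Along the line through \<open>t\<close> in the direction of \<open>z\<close>,
      both \<open>T\<close> and \<open>G\<close> vanish at 0. So \<open>z Q\<close> is divisible by
      \<open>z^2\<close> there, and \<open>Q\<close> by \<open>z\<close>.\<close>
    have "poly ([:0, 1:] * P - [:0, 1:] * [:0, 1:] * R' * S') s = 0" for s
      using zQ[of s x y] by (simp add: P R S RS algebra_simps)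
    then have "[:0, 1:] * (P - [:0, 1:] * R' * S') = 0"
      by (intro poly_eq_0_cofinite[of "{}"]) (auto simp: algebra_simps)
    then have "P = [:0, 1:] * R' * S'"
      by (metis eq_iff_diff_eq_0 mult_eq_0_iff one_neq_zero pCons_eq_0_iff)
    then show ?thesis
      using P[of 0] by (simp add: t True)
  next
    case False
    then show ?thesis
      using off \<open>T t = 0\<close> t by blast
  qed
qed

end

section \<open>Linear maps of the projective plane\<close>

definition linear_triple :: "('a::alg_closed_field triple \<Rightarrow> 'a triple) \<Rightarrow> bool" where
  "linear_triple L \<longleftrightarrow> (\<exists>L\<^sub>0 L\<^sub>1 L\<^sub>2. form 1 L\<^sub>0 \<and> form 1 L\<^sub>1 \<and> form 1 L\<^sub>2 \<and>
     L = (\<lambda>t. (L\<^sub>0 t, L\<^sub>1 t, L\<^sub>2 t)))"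

lemma linear_triple_scale: "linear_triple L \<Longrightarrow> L (scale c t) = scale c (L t)"
  unfolding linear_triple_def by (auto simp: form_scale)

lemma linear_triple_image_proj:
  assumes "linear_triple L"
  shows "L ` proj t = proj (L t)"
  by (simp add: proj_scale_image setcompr_eq_image image_image linear_triple_scale[OF assms])

lemma form_linear_triple: "form n F \<Longrightarrow> linear_triple L \<Longrightarrow> form n (\<lambda>t. F (L t))"
  unfolding linear_triple_def using form_compose[of n F 1] by auto

lemma proj_in_proj_plane: "proj t \<in> proj_plane \<longleftrightarrow> t \<noteq> (0, 0, 0)"
proof
  assume "proj t \<in> proj_plane"
  then obtain u where "u \<noteq> (0, 0, 0)" "proj t = proj u"
    unfolding proj_plane_def by blast
  then show "t \<noteq> (0, 0, 0)"
    by (auto simp: proj_eq_iff)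
qed (auto simp: proj_plane_def)

lemma zero_locus_subset_proj_plane: "zero_locus H \<subseteq> proj_plane"
  unfolding zero_locus_def proj_plane_def by blast

lemma morphism_linear_triple:
  assumes "linear_triple L" and "\<And>t. L t = (0, 0, 0) \<Longrightarrow> t = (0, 0, 0)"
    and "A \<subseteq> proj_plane" and "(`) L ` A \<subseteq> B"
  shows "morphism A B ((`) L)"
  unfolding morphism_def
proof (intro conjI ballI)
  fix P
  assume "P \<in> A"
  then obtain t\<^sub>0 where "P = proj t\<^sub>0"
    using assms(3) unfolding proj_plane_def by blast
  then have "t\<^sub>0 \<in> P"
    by simp
  obtain L\<^sub>0 L\<^sub>1 L\<^sub>2 where L: "form 1 L\<^sub>0" "form 1 L\<^sub>1" "form 1 L\<^sub>2"
    "L = (\<lambda>t. (L\<^sub>0 t, L\<^sub>1 t, L\<^sub>2 t))"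
    using assms(1) unfolding linear_triple_def by blast
  have local_forms: "(L\<^sub>0 t, L\<^sub>1 t, L\<^sub>2 t) \<noteq> (0, 0, 0)
      \<and> L ` proj t = proj (L\<^sub>0 t, L\<^sub>1 t, L\<^sub>2 t)"
    if "proj t \<in> A" for t
  proof -
    have "t \<noteq> (0, 0, 0)"
      using that assms(3) proj_in_proj_plane[of t] by blast
    then have "L t \<noteq> (0, 0, 0)"
      using assms(2) by blast
    moreover have "L t = (L\<^sub>0 t, L\<^sub>1 t, L\<^sub>2 t)"
      by (subst L(4)) simp
    ultimately show ?thesis
      using linear_triple_image_proj[OF assms(1), of t] by simp
  qed
  show "\<exists>n F\<^sub>0 F\<^sub>1 F\<^sub>2 m H.
      form n F\<^sub>0 \<and> form n F\<^sub>1 \<and> form n F\<^sub>2 \<and> form m H \<and> (\<exists>t\<in>P. H t \<noteq> 0) \<and>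
      (\<forall>t. proj t \<in> A \<and> H t \<noteq> 0 \<longrightarrow>
         (F\<^sub>0 t, F\<^sub>1 t, F\<^sub>2 t) \<noteq> (0, 0, 0) \<and> L ` proj t = proj (F\<^sub>0 t, F\<^sub>1 t, F\<^sub>2 t))"
  proof (intro exI conjI)
    \<comment> \<open>One chart covers everything: \<open>H\<close> is the constant 1.\<close>
    show "form 1 L\<^sub>0" "form 1 L\<^sub>1" "form 1 L\<^sub>2" "form 0 (\<lambda>_. 1 :: 'a)"
      by (rule L form_const)+
    show "\<exists>t\<in>P. (1 :: 'a) \<noteq> 0"
      using \<open>t\<^sub>0 \<in> P\<close> by (intro bexI[of _ t\<^sub>0]) simp_all
    show "\<forall>t. proj t \<in> A \<and> (1 :: 'a) \<noteq> 0 \<longrightarrow>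
        (L\<^sub>0 t, L\<^sub>1 t, L\<^sub>2 t) \<noteq> (0, 0, 0) \<and> L ` proj t = proj (L\<^sub>0 t, L\<^sub>1 t, L\<^sub>2 t)"
      using local_forms by blast
  qed
qed (rule assms(4))

lemma morphism_cong:
  assumes "\<And>P. P \<in> A \<Longrightarrow> \<phi> P = \<psi> P"
  shows "morphism A B \<phi> \<longleftrightarrow> morphism A B \<psi>"
proof -
  have "\<phi> ` A = \<psi> ` A"
    using assms by auto
  then show ?thesis
    unfolding morphism_def using assms by (simp cong: conj_cong)
qed

text \<open>The map \<open>\<phi>\<close> need only agree with the linear map on \<open>A\<close>,
  because an induced morphism is determined on the curve alone. The inverse on the image is induced
  by \<open>M\<close>.\<close>

lemma embedding_linear_triple:
  assumes L: "linear_triple L" and M: "linear_triple M"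
    and inv1: "\<And>t. M (L t) = t" and inv2: "\<And>t. L (M t) = t"
    and A: "A \<subseteq> proj_plane" and \<phi>: "\<And>P. P \<in> A \<Longrightarrow> \<phi> P = L ` P"
  shows "embedding A \<phi>"
proof -
  have 0: "K (0, 0, 0) = (0, 0, 0)" if "linear_triple K" for K :: "'a triple \<Rightarrow> 'a triple"
    using linear_triple_scale[OF that, of 0 "(0, 0, 0)"] by (cases "K (0, 0, 0)") simp
  have ker: "t = (0, 0, 0)" if "L t = (0, 0, 0)" for t
    using inv1[of t, symmetric] 0[OF M] that by metis
  have ker': "t = (0, 0, 0)" if "M t = (0, 0, 0)" for t
    using inv2[of t, symmetric] 0[OF L] that by metis
  have inverse: "M ` L ` P = P" for P
    by (simp add: image_image inv1)
  have inj: "inj_on \<phi> A"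
    using \<phi> inverse by (metis inj_onI)
  have B: "\<phi> ` A \<subseteq> proj_plane"
  proof
    fix Q
    assume "Q \<in> \<phi> ` A"
    then obtain P where P: "P \<in> A" "Q = L ` P"
      using \<phi> by auto
    then obtain t where t: "P = proj t" "t \<noteq> (0, 0, 0)"
      using A unfolding proj_plane_def by blast
    have "proj (L t) \<in> proj_plane"
      using ker[of t] t(2) unfolding proj_in_proj_plane by blast
    then show "Q \<in> proj_plane"
      unfolding P(2) t(1) linear_triple_image_proj[OF L] .
  qed
  have inv: "inv_into A \<phi> Q = M ` Q" if Q: "Q \<in> \<phi> ` A" for Q
  proof -
    obtain P where P: "P \<in> A" "Q = \<phi> P"
      using Q by blast
    have "inv_into A \<phi> Q = P"
      unfolding P(2) by (rule inv_into_f_f[OF inj P(1)])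
    moreover have "M ` Q = P"
      by (simp add: P(2) \<phi>[OF P(1)] inverse)
    ultimately show ?thesis
      by simp
  qed
  have "morphism A (\<phi> ` A) ((`) L)"
    using \<phi> by (intro morphism_linear_triple[OF L ker A]) auto
  moreover have "morphism (\<phi> ` A) A ((`) M)"
    using \<phi> inverse by (intro morphism_linear_triple[OF M ker' B]) auto
  ultimately have "morphism A (\<phi> ` A) \<phi>" "morphism (\<phi> ` A) A (inv_into A \<phi>)"
    using morphism_cong[of A \<phi> "(`) L"] morphism_cong[of "\<phi> ` A" "inv_into A \<phi>" "(`) M"] \<phi> inv
    by auto
  with inj B show ?thesis
    unfolding embedding_def isomorphism_def by (simp add: bij_betw_def)
qed

lemma cut_out_by_cmult:
  assumes "cut_out_by S H" and "c \<noteq> 0"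
  shows "cut_out_by S (\<lambda>t. c * H t)"
  unfolding cut_out_by_def
proof (intro conjI allI impI)
  show "S = zero_locus (\<lambda>t. c * H t)"
    using assms by (simp add: cut_out_by_def zero_locus_def)
  fix n F
  assume "form n F \<and> (\<forall>t. proj t \<in> S \<longrightarrow> F t = 0)"
  then obtain m G where G: "form m G" "F = (\<lambda>t. H t * G t)"
    using assms(1) unfolding cut_out_by_def by blast
  from form_cmult[OF G(1), of "1 / c"] show "\<exists>m G. form m G \<and> F = (\<lambda>t. c * H t * G t)"
    using G(2) assms(2) by (intro exI[of _ m] exI[of _ "\<lambda>t. 1 / c * G t"]) auto
qed

section \<open>The curve \<open>y\<^sup>2 = x\<^sup>3 + a (x - b)\<^sup>2\<close>\<close>

locale split_weierstrass =
  fixes a' b :: "'a::alg_closed_field"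
  assumes two: "(2 :: 'a) \<noteq> 0" and a': "a' \<noteq> 0" and b: "b \<noteq> 0"
begin

lemma four: "(4 :: 'a) \<noteq> 0"
proof -
  have "(4 :: 'a) = 2 * 2"
    by simp
  then show ?thesis
    using two by (metis mult_eq_0_iff)
qed

lemma form_line: "form 1 (\<lambda>(x, y, z). c * x + d * y + e * z)"
  using form_add[OF form_add[OF form_cmult[OF form_X, of c] form_cmult[OF form_Y, of d]]
      form_cmult[OF form_Z, of e]]
  by (simp add: case_prod_beta')

text \<open>Here \<open>(x, y, z)\<close> are the target coordinates \<open>(w, u, x)\<close> of the
  curve. The relation \<open>w - u = 2 a' (x - b z)\<close> expresses the old \<open>z\<close>
  through them, and substitution into \<open>u w z = x^3\<close> gives these two
  coefficients.\<close>

sublocale depressed_cubic "\<lambda>(x, y, z). x * y / b" "\<lambda>(x, y, z). x * y * (y - x) / (2 * a' * b)"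
proof
  have xy: "form 2 (\<lambda>(x, y, z). x * y)"
    using form_mult[OF form_X form_Y] by (simp add: case_prod_beta' numeral_2_eq_2)
  from form_cmult[OF this, of "1 / b"] show "form 2 (\<lambda>(x, y, z). x * y / b)"
    by (simp add: case_prod_beta')
  from form_cmult[OF form_mult[OF xy form_line[of "- 1" 1 0]], of "1 / (2 * a' * b)"]
  show "form 3 (\<lambda>(x, y, z). x * y * (y - x) / (2 * a' * b))"
    by (simp add: case_prod_beta' numeral_3_eq_3)
qed (simp_all add: z_free_def)

definition L :: "'a triple \<Rightarrow> 'a triple" where
  "L = (\<lambda>(x, y, z). (y + a' * (x - b * z), y - a' * (x - b * z), x))"

text \<open>The inverse of \<open>L\<close>: the old \<open>y\<close> is half the sum of the first
  two coordinates, and the old \<open>z\<close> comes from their difference.\<close>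

definition M :: "'a triple \<Rightarrow> 'a triple" where
  "M = (\<lambda>(x, y, z). (z, (x + y) / 2, (2 * a' * z - (x - y)) / (2 * a' * b)))"

definition W :: "'a weierstrass" where
  "W = Weierstrass 0 (a' ^ 2) 0 (- 2 * a' ^ 2 * b) (a' ^ 2 * b ^ 2)"

lemma linear_L: "linear_triple L"
  unfolding linear_triple_def
  by (rule exI[of _ "\<lambda>(x, y, z). a' * x + 1 * y + (- a' * b) * z"],
      rule exI[of _ "\<lambda>(x, y, z). (- a') * x + 1 * y + (a' * b) * z"],
      rule exI[of _ "\<lambda>(x, y, z). 1 * x + 0 * y + 0 * z"], intro conjI form_line)
    (auto simp: L_def fun_eq_iff algebra_simps)

lemma linear_M: "linear_triple M"
  unfolding linear_triple_def
  by (rule exI[of _ "\<lambda>(x, y, z). 0 * x + 0 * y + 1 * z"],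
      rule exI[of _ "\<lambda>(x, y, z). (1 / 2) * x + (1 / 2) * y + 0 * z"],
      rule exI[of _ "\<lambda>(x, y, z). (- 1 / (2 * a' * b)) * x + (1 / (2 * a' * b)) * y + (1 / b) * z"],
      intro conjI form_line)
    (use two a' b in \<open>auto simp: M_def fun_eq_iff field_simps\<close>)

lemma M_L: "M (L t) = t"
  using two four a' b by (cases t) (simp add: L_def M_def field_simps)

lemma L_M: "L (M t) = t"
  using two four a' b by (cases t) (simp add: L_def M_def field_simps)

lemma weierstrass_form_W:
  "weierstrass_form W (x, y, z) = y ^ 2 * z - (x ^ 3 + a' ^ 2 * (x - b * z) ^ 2 * z)"
  by (simp add: W_def weierstrass_form_def algebra_simps power2_eq_square power3_eq_cube)

lemma T_L: "T (L t) = - weierstrass_form W t"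
proof (cases t)
  case (fields x y z)
  have sq: "(y + a' * (x - b * z)) * (y - a' * (x - b * z)) = y ^ 2 - a' ^ 2 * (x - b * z) ^ 2"
    by (simp add: algebra_simps power2_eq_square)
  have diff: "y - a' * (x - b * z) - (y + a' * (x - b * z)) = - (2 * a' * (x - b * z))"
    by simp
  have "T (L t) = x ^ 3 - (y ^ 2 - a' ^ 2 * (x - b * z) ^ 2) / b * x
      + (y ^ 2 - a' ^ 2 * (x - b * z) ^ 2) * (2 * a' * (x - b * z)) / (2 * a' * b)"
    unfolding T_def L_def fields case_prod_conv sq diff by simp
  also have "\<dots> = x ^ 3 - (y ^ 2 - a' ^ 2 * (x - b * z) ^ 2) * z"
    using two a' b by (simp add: field_simps)
  finally show ?thesis
    unfolding fields weierstrass_form_W by (simp add: algebra_simps)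
qed

lemma form_W: "form 3 (weierstrass_form W)"
  using form_uminus[OF form_linear_triple[OF form_T linear_L]] by (simp add: T_L)

lemma proj_in_curve: "proj t \<in> curve W \<longleftrightarrow> t \<noteq> (0, 0, 0) \<and> weierstrass_form W t = 0"
  unfolding curve_def by (rule proj_in_zero_locus[OF form_W])

lemma L_eq_0_iff: "L t = (0, 0, 0) \<longleftrightarrow> t = (0, 0, 0)"
proof
  assume "L t = (0, 0, 0)"
  then have "M (L t) = M (0, 0, 0)"
    by simp
  also have "\<dots> = (0, 0, 0)"
    by (simp add: M_def)
  finally show "t = (0, 0, 0)"
    by (simp add: M_L)
qed (simp add: L_def)

text \<open>The point \<open>(1, 1, 0)\<close> is chosen because the coefficient of degree 3
  vanishes there, which leaves \<open>4 / b^3\<close>.\<close>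

lemma disc_nonzero:
  "4 * (case (1, 1, 0) of (x, y, z) \<Rightarrow> x * y / b) ^ 3
     - 27 * (case (1, 1, 0) of (x, y, z) \<Rightarrow> x * y * (y - x) / (2 * a' * b)) ^ 2 \<noteq> 0"
  using four b by simp

lemma image_curve: "(`) L ` curve W = zero_locus T"
proof
  show "(`) L ` curve W \<subseteq> zero_locus T"
    unfolding curve_def zero_locus_def[of "weierstrass_form W"]
    by (auto simp: linear_triple_image_proj[OF linear_L] proj_in_zero_locus[OF form_T] T_L
        L_eq_0_iff[simplified])
  show "zero_locus T \<subseteq> (`) L ` curve W"
  proof
    fix P
    assume "P \<in> zero_locus T"
    then obtain t where t: "P = proj t" "t \<noteq> (0, 0, 0)" "T t = 0"
      unfolding zero_locus_def by blast
    have "proj (M t) \<in> curve W"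
      unfolding proj_in_curve using t(2,3) T_L[of "M t"] L_eq_0_iff[of "M t"] by (simp add: L_M)
    moreover have "P = L ` proj (M t)"
      by (simp add: linear_triple_image_proj[OF linear_L] L_M t(1))
    ultimately show "P \<in> (`) L ` curve W"
      by blast
  qed
qed

text \<open>This is \<open>vanishes_on_cubic\<close> transported by \<open>M\<close>; the third
  coordinate of \<open>L\<close> is \<open>x\<close>, so the condition \<open>z \<noteq> 0\<close>
  becomes \<open>x \<noteq> 0\<close>.\<close>

lemma vanishes_on_curve:
  assumes "form n Q"
    and "\<And>x y z. weierstrass_form W (x, y, z) = 0 \<Longrightarrow> x \<noteq> 0 \<Longrightarrow> Q (x, y, z) = 0"
    and "weierstrass_form W t = 0"
  shows "Q t = 0"
proof -
  have "Q (M (L t)) = 0"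
  proof (rule vanishes_on_cubic[OF disc_nonzero _ form_linear_triple[OF assms(1) linear_M]])
    \<comment> \<open>The value at this point is \<open>1 / (a' b)\<close>.\<close>
    show "(case (1, - 1, 0) of (x, y, z) \<Rightarrow> x * y * (y - x) / (2 * a' * b)) \<noteq> 0"
      using two a' b by simp
    show "Q (M (x, y, z)) = 0" if "T (x, y, z) = 0" "z \<noteq> 0" for x y z
    proof -
      have "weierstrass_form W (M (x, y, z)) = 0"
        using T_L[of "M (x, y, z)"] that(1) by (simp add: L_M)
      moreover have "M (x, y, z) = (z, fst (snd (M (x, y, z))), snd (snd (M (x, y, z))))"
        by (simp add: M_def)
      ultimately show ?thesis
        using assms(2) that(2) by metis
    qed
    show "T (L t) = 0"
      using assms(3) by (simp add: T_L)
  qed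
  then show ?thesis
    by (simp add: M_L)
qed

text \<open>The sign of \<open>e\<close> treats \<open>f\<close> and \<open>g\<close> together. For
  a representing fraction \<open>F / G\<close>, the form \<open>x F - l G\<close> vanishes where
  \<open>x \<noteq> 0\<close>, hence on the whole curve. The conclusion is free of division so as to
  cover \<open>x = 0\<close> too.\<close>

lemma has_value_rat_fun:
  assumes e: "e = a' \<or> e = - a'" and P: "proj (x, y, z) \<in> curve W"
    and "has_value (rat_fun W (\<lambda>x y. x ^ 2) (\<lambda>x y. y - e * (x - b))) (proj (x, y, z)) c"
  shows "x * c = y + e * (x - b * z)"
proof -
  obtain F G s where FG: "(F, G) \<in> rat_fun W (\<lambda>x y. x ^ 2) (\<lambda>x y. y - e * (x - b))"
    and s: "s \<in> proj (x, y, z)" "G s \<noteq> 0" "c = F s / G s"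
    using assms(3) unfolding has_value_def by blast
  obtain n where F: "form n F" and G: "form n G"
    and rat: "\<And>x y. proj (x, y, 1) \<in> curve W \<Longrightarrow>
      x ^ 2 * G (x, y, 1) = (y - e * (x - b)) * F (x, y, 1)"
    using FG unfolding rat_fun_def by blast
  define l :: "'a triple \<Rightarrow> 'a" where "l = (\<lambda>(x, y, z). y + e * (x - b * z))"
  have l: "form 1 l"
    using form_line[of e 1 "- e * b"] by (simp add: l_def case_prod_beta' algebra_simps)
  define Q where "Q t = (case t of (x, y, z) \<Rightarrow> x) * F t - l t * G t" for t
  have Q: "form (1 + n) Q"
    unfolding Q_def by (intro form_diff form_mult form_X F l G)
  have vanish: "Q (x, y, z) = 0" if w: "weierstrass_form W (x, y, z) = 0" and x: "x \<noteq> 0" for x y z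
  proof -
    \<comment> \<open>On the line \<open>z = 0\<close> the equation reduces to
      \<open>x^3 = 0\<close>.\<close>
    have z: "z \<noteq> 0"
      using w x by (auto simp: weierstrass_form_W)
    define X Y where "X = x / z" and "Y = y / z"
    have xyz: "(x, y, z) = scale z (X, Y, 1)"
      using z by (simp add: X_def Y_def)
    have w1: "weierstrass_form W (X, Y, 1) = 0"
      using w z unfolding xyz form_scale[OF form_W] by simp
    then have sq: "Y ^ 2 - a' ^ 2 * (X - b) ^ 2 = X ^ 3"
      by (simp add: weierstrass_form_W algebra_simps)
    have "proj (X, Y, 1) \<in> curve W"
      using w1 by (simp add: proj_in_curve)
    \<comment> \<open>Multiplication by the conjugate factor turns the right-hand side into
      \<open>X^3 F\<close>, after which \<open>X^2\<close> cancels.\<close>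
    from rat[OF this] have "(Y + e * (X - b)) * (X ^ 2 * G (X, Y, 1))
        = (Y + e * (X - b)) * (Y - e * (X - b)) * F (X, Y, 1)"
      by simp
    also have "(Y + e * (X - b)) * (Y - e * (X - b)) = Y ^ 2 - a' ^ 2 * (X - b) ^ 2"
      using e by (auto simp: algebra_simps power2_eq_square)
    also have "\<dots> = X ^ 2 * X"
      unfolding sq by (simp add: power2_eq_square power3_eq_cube)
    finally have "X ^ 2 * Q (X, Y, 1) = 0"
      by (simp add: Q_def l_def algebra_simps)
    then have "Q (X, Y, 1) = 0"
      using x z by (simp add: X_def)
    then show "Q (x, y, z) = 0"
      unfolding xyz form_scale[OF Q] by simp
  qed
  obtain k where k: "k \<noteq> 0" "s = scale k (x, y, z)"
    using s(1) unfolding proj_scale_image by blast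
  then have "weierstrass_form W s = 0"
    using P unfolding proj_in_curve k(2) form_scale[OF form_W] by simp
  with vanish have "Q s = 0"
    by (rule vanishes_on_curve[OF Q])
  then have "k * x * F s = l s * G s"
    by (simp add: Q_def k(2))
  then have "k * x * c = l s"
    using s(2) by (simp add: s(3) field_simps)
  also have "l s = k * l (x, y, z)"
    unfolding k(2) form_scale[OF l] by simp
  finally show ?thesis
    using k(1) by (simp add: l_def mult.assoc)
qed

lemma has_value_rat_fun':
  assumes e: "e = a' \<or> e = - a'" and "x \<noteq> 0"
  shows "has_value (rat_fun W (\<lambda>x y. x ^ 2) (\<lambda>x y. y - e * (x - b))) (proj (x, y, z))
    ((y + e * (x - b * z)) / x)"
proof -
  define F :: "'a triple \<Rightarrow> 'a" where "F = (\<lambda>(x, y, z). y + e * (x - b * z))"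
  define G :: "'a triple \<Rightarrow> 'a" where "G = (\<lambda>(x, y, z). x)"
  have "form 1 F" "form 1 G"
    using form_line[of e 1 "- e * b"] form_X
    by (simp_all add: F_def G_def case_prod_beta' algebra_simps)
  moreover have "\<exists>t. proj t \<in> curve W \<and> G t \<noteq> 0"
  proof -
    \<comment> \<open>A point of the curve with \<open>x = 1\<close>, which shows that the
      denominator \<open>x\<close> is not identically zero there.\<close>
    obtain y where "y ^ 2 = 1 + a' ^ 2 * (1 - b) ^ 2"
      using nth_root_exists[of 2] by auto
    then have "proj (1, y, 1) \<in> curve W"
      by (simp add: proj_in_curve weierstrass_form_W)
    then show ?thesis
      by (intro exI[of _ "(1, y, 1)"]) (simp add: G_def)
  qed
  moreover have "x ^ 2 * G (x, y, 1) = (y - e * (x - b)) * F (x, y, 1)"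
    if "proj (x, y, 1) \<in> curve W" for x y
  proof -
    have "x ^ 3 = y ^ 2 - a' ^ 2 * (x - b) ^ 2"
      using that by (simp add: proj_in_curve weierstrass_form_W algebra_simps)
    also have "\<dots> = (y - e * (x - b)) * (y + e * (x - b))"
      using e by (auto simp: algebra_simps power2_eq_square)
    finally show ?thesis
      by (simp add: F_def G_def power2_eq_square power3_eq_cube)
  qed
  ultimately have "(F, G) \<in> rat_fun W (\<lambda>x y. x ^ 2) (\<lambda>x y. y - e * (x - b))"
    unfolding rat_fun_def by blast
  then show ?thesis
    unfolding has_value_def using assms(2)
    by (intro exI[of _ F] exI[of _ G] exI[of _ "(x, y, z)"]) (simp add: F_def G_def)
qed

section \<open>Existence and uniqueness of the induced morphism\<close>

abbreviation f :: "'a fractions" where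
  "f \<equiv> rat_fun W (\<lambda>x y. x ^ 2) (\<lambda>x y. y - a' * (x - b))"

abbreviation g :: "'a fractions" where
  "g \<equiv> rat_fun W (\<lambda>x y. x ^ 2) (\<lambda>x y. y + a' * (x - b))"

lemma curve_subset: "curve W \<subseteq> proj_plane"
  unfolding curve_def by (rule zero_locus_subset_proj_plane)

lemma induced_morphism_L: "induced_morphism W f g ((`) L)"
  unfolding induced_morphism_def
proof (intro conjI ballI allI impI)
  show "morphism (curve W) proj_plane ((`) L)"
    using image_curve zero_locus_subset_proj_plane
    by (intro morphism_linear_triple linear_L curve_subset) (simp_all add: L_eq_0_iff)
  fix P c d
  assume "P \<in> curve W" and val: "has_value f P c \<and> has_value g P d"
  then obtain t where P: "P = proj t" "t \<noteq> (0, 0, 0)"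
    using curve_subset unfolding proj_plane_def by blast
  obtain x y z where t: "t = (x, y, z)"
    by (cases t)
  have "x * c = y + a' * (x - b * z)"
    using has_value_rat_fun[of a' x y z c] val \<open>P \<in> curve W\<close> by (simp add: P(1) t)
  moreover have "x * d = y - a' * (x - b * z)"
    using has_value_rat_fun[of "- a'" x y z d] val \<open>P \<in> curve W\<close> by (simp add: P(1) t)
  ultimately have "L t = scale x (c, d, 1)"
    by (simp add: L_def t)
  \<comment> \<open>If \<open>f\<close> and \<open>g\<close> both have values at the point, then
    \<open>x = 0\<close> would make \<open>L t\<close> the zero triple.\<close>
  moreover from this have "x \<noteq> 0"
    using L_eq_0_iff[of t] P(2) by auto
  ultimately show "L ` P = proj (c, d, 1)"
    unfolding P(1) linear_triple_image_proj[OF linear_L] proj_eq_iff by blast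
qed

text \<open>Where \<open>x \<noteq> 0\<close>, the values of \<open>f\<close> and \<open>g\<close>
  force \<open>\<phi>\<close> to agree with \<open>L\<close>. Near \<open>P\<close> this makes the 2
  by 2 minors of the local forms against those of \<open>L\<close> vanish, and
  \<open>vanishes_on_curve\<close> extends this to \<open>P\<close> even if \<open>x = 0\<close>
  there.\<close>

lemma induced_morphism_unique:
  assumes "induced_morphism W f g \<phi>" and "P \<in> curve W"
  shows "\<phi> P = L ` P"
proof -
  have "morphism (curve W) proj_plane \<phi>"
    using assms(1) unfolding induced_morphism_def by (rule conjunct1)
  note bspec[OF conjunct2[OF this[unfolded morphism_def]] assms(2)]
  then obtain n F\<^sub>0 F\<^sub>1 F\<^sub>2 m H where F: "form n F\<^sub>0" "form n F\<^sub>1" "form n F\<^sub>2" and H: "form m H"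
    and H_ex: "\<exists>t\<in>P. H t \<noteq> 0"
    and eq_all: "\<forall>t. proj t \<in> curve W \<and> H t \<noteq> 0 \<longrightarrow>
       (F\<^sub>0 t, F\<^sub>1 t, F\<^sub>2 t) \<noteq> (0, 0, 0) \<and> \<phi> (proj t) = proj (F\<^sub>0 t, F\<^sub>1 t, F\<^sub>2 t)"
    by (elim exE conjE)
  have eq: "(F\<^sub>0 t, F\<^sub>1 t, F\<^sub>2 t) \<noteq> (0, 0, 0)" "\<phi> (proj t) = proj (F\<^sub>0 t, F\<^sub>1 t, F\<^sub>2 t)"
    if "proj t \<in> curve W" "H t \<noteq> 0" for t
    using eq_all that by blast+
  from H_ex obtain t\<^sub>0 where t\<^sub>0: "t\<^sub>0 \<in> P" "H t\<^sub>0 \<noteq> 0"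
    by blast
  obtain u where "P = proj u"
    using assms(2) curve_subset unfolding proj_plane_def by blast
  with t\<^sub>0(1) have P: "P = proj t\<^sub>0"
    by (simp add: in_proj_iff)
  then have t\<^sub>0_curve: "t\<^sub>0 \<noteq> (0, 0, 0)" "weierstrass_form W t\<^sub>0 = 0"
    using assms(2) by (simp_all add: proj_in_curve)
  obtain L\<^sub>0 L\<^sub>1 L\<^sub>2 where L: "form 1 L\<^sub>0" "form 1 L\<^sub>1" "form 1 L\<^sub>2"
    and L_eq: "\<And>t. L t = (L\<^sub>0 t, L\<^sub>1 t, L\<^sub>2 t)"
    using linear_L unfolding linear_triple_def by auto
  have generic: "proj (F\<^sub>0 t, F\<^sub>1 t, F\<^sub>2 t) = proj (L t)"
    if "weierstrass_form W t = 0" "fst t \<noteq> 0" "H t \<noteq> 0" for t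
  proof -
    obtain x y z where t: "t = (x, y, z)"
      by (cases t)
    with that have x: "x \<noteq> 0" and curve: "proj t \<in> curve W"
      by (auto simp: proj_in_curve)
    define c d where "c = (y + a' * (x - b * z)) / x" and "d = (y - a' * (x - b * z)) / x"
    have "has_value f (proj t) c" "has_value g (proj t) d"
      using has_value_rat_fun'[of a' x y z] has_value_rat_fun'[of "- a'" x y z] x
      by (simp_all add: t c_def d_def)
    then have "\<phi> (proj t) = proj (c, d, 1)"
      using assms(1) curve unfolding induced_morphism_def by blast
    also have "L t = scale x (c, d, 1)"
      using x by (simp add: t L_def c_def d_def)
    then have "proj (c, d, 1) = proj (L t)"
      using x proj_eq_iff by metis
    finally show ?thesis
      using eq(2)[OF curve that(3)] by simp
  qed
  \<comment> \<open>The hypothesis \<open>par\<close> lets one argument serve all three pairs of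
    coordinates.\<close>
  have cross: "F t\<^sub>0 * K' t\<^sub>0 = F' t\<^sub>0 * K t\<^sub>0"
    if F: "form n F" "form n F'" and K: "form 1 K" "form 1 K'"
      and par: "\<And>c t. (F\<^sub>0 t, F\<^sub>1 t, F\<^sub>2 t) = scale c (L t) \<Longrightarrow> F t = c * K t \<and> F' t = c * K' t"
    for F F' K K'
  proof -
    \<comment> \<open>The local forms describe \<open>\<phi>\<close> only where
      \<open>H \<noteq> 0\<close>; the factor \<open>H\<close> makes the product vanish at the other
      points as well, and it is nonzero at \<open>t\<^sub>0\<close>.\<close>
    have "form (m + (n + 1)) (\<lambda>t. H t * (F t * K' t - F' t * K t))"
      by (intro form_mult H form_diff F K)
    moreover have "H (x, y, z) * (F (x, y, z) * K' (x, y, z) - F' (x, y, z) * K (x, y, z)) = 0"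
      if xyz: "weierstrass_form W (x, y, z) = 0" "x \<noteq> 0" for x y z
    proof (cases "H (x, y, z) = 0")
      case False
      then obtain c where "(F\<^sub>0 (x, y, z), F\<^sub>1 (x, y, z), F\<^sub>2 (x, y, z)) = scale c (L (x, y, z))"
        using generic[of "(x, y, z)"] xyz by (auto simp: proj_eq_iff)
      from par[OF this] show ?thesis
        by (simp add: algebra_simps)
    qed simp
    ultimately have "H t\<^sub>0 * (F t\<^sub>0 * K' t\<^sub>0 - F' t\<^sub>0 * K t\<^sub>0) = 0"
      by (rule vanishes_on_curve[OF _ _ t\<^sub>0_curve(2)])
    then show ?thesis
      using t\<^sub>0(2) by simp
  qed
  have 01: "F\<^sub>0 t\<^sub>0 * L\<^sub>1 t\<^sub>0 = F\<^sub>1 t\<^sub>0 * L\<^sub>0 t\<^sub>0" and 02: "F\<^sub>0 t\<^sub>0 * L\<^sub>2 t\<^sub>0 = F\<^sub>2 t\<^sub>0 * L\<^sub>0 t\<^sub>0"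
    and 12: "F\<^sub>1 t\<^sub>0 * L\<^sub>2 t\<^sub>0 = F\<^sub>2 t\<^sub>0 * L\<^sub>1 t\<^sub>0"
    by (rule cross; (rule F L | simp add: L_eq))+
  have L0: "(L\<^sub>0 t\<^sub>0, L\<^sub>1 t\<^sub>0, L\<^sub>2 t\<^sub>0) \<noteq> (0, 0, 0)"
    using L_eq_0_iff[of t\<^sub>0] t\<^sub>0_curve(1) by (simp add: L_eq)
  have F0: "(F\<^sub>0 t\<^sub>0, F\<^sub>1 t\<^sub>0, F\<^sub>2 t\<^sub>0) \<noteq> (0, 0, 0)"
    and \<phi>: "\<phi> P = proj (F\<^sub>0 t\<^sub>0, F\<^sub>1 t\<^sub>0, F\<^sub>2 t\<^sub>0)"
    using eq[of t\<^sub>0] t\<^sub>0(2) assms(2) unfolding P by blast+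
  have "\<exists>c. (F\<^sub>0 t\<^sub>0, F\<^sub>1 t\<^sub>0, F\<^sub>2 t\<^sub>0) = scale c (L\<^sub>0 t\<^sub>0, L\<^sub>1 t\<^sub>0, L\<^sub>2 t\<^sub>0)"
  proof -
    \<comment> \<open>With all minors zero the two triples are parallel; the factor is read off at a
      nonzero coordinate of \<open>L t\<^sub>0\<close>.\<close>
    consider "L\<^sub>0 t\<^sub>0 \<noteq> 0" | "L\<^sub>1 t\<^sub>0 \<noteq> 0" | "L\<^sub>2 t\<^sub>0 \<noteq> 0"
      using L0 by auto
    then show ?thesis
    proof cases
      case 1
      then show ?thesis
        using 01 02 by (intro exI[of _ "F\<^sub>0 t\<^sub>0 / L\<^sub>0 t\<^sub>0"]) (simp add: field_simps)
    next
      case 2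
      then show ?thesis
        using 01 12 by (intro exI[of _ "F\<^sub>1 t\<^sub>0 / L\<^sub>1 t\<^sub>0"]) (simp add: field_simps)
    next
      case 3
      then show ?thesis
        using 02 12 by (intro exI[of _ "F\<^sub>2 t\<^sub>0 / L\<^sub>2 t\<^sub>0"]) (simp add: field_simps)
    qed
  qed
  then obtain c where c: "(F\<^sub>0 t\<^sub>0, F\<^sub>1 t\<^sub>0, F\<^sub>2 t\<^sub>0) = scale c (L t\<^sub>0)"
    unfolding L_eq by blast
  moreover have "c \<noteq> 0"
    using c F0 by auto
  ultimately have "proj (F\<^sub>0 t\<^sub>0, F\<^sub>1 t\<^sub>0, F\<^sub>2 t\<^sub>0) = proj (L t\<^sub>0)"
    unfolding proj_eq_iff by blast
  then show ?thesis
    using \<phi> by (simp add: P linear_triple_image_proj[OF linear_L])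
qed

lemma embedding_cut_out:
  assumes "induced_morphism W f g \<phi>"
  shows "embedding (curve W) \<phi>"
    and "cut_out_by (\<phi> ` curve W)
      (\<lambda>(F, G, Z). F * G ^ 2 + 2 * a' * F * G * Z - F ^ 2 * G - 2 * a' * b * Z ^ 3)"
proof -
  note \<phi> = induced_morphism_unique[OF assms]
  show "embedding (curve W) \<phi>"
    by (rule embedding_linear_triple[OF linear_L linear_M M_L L_M curve_subset \<phi>])
  have "\<phi> ` curve W = zero_locus T"
    unfolding image_curve[symmetric] using \<phi> by (intro image_cong) auto
  \<comment> \<open>Clearing the denominators of \<open>T\<close> produces the factor
    \<open>- (2 * a' * b)\<close>, which does not change the ideal.\<close>
  moreover have "(\<lambda>(F, G, Z). F * G ^ 2 + 2 * a' * F * G * Z - F ^ 2 * G - 2 * a' * b * Z ^ 3)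
      = (\<lambda>t. - (2 * a' * b) * T t)"
    unfolding T_def using two a' b
    by (auto simp: fun_eq_iff field_simps power2_eq_square power3_eq_cube)
  moreover have "- (2 * a' * b) \<noteq> 0"
    using two a' b by simp
  ultimately show "cut_out_by (\<phi> ` curve W)
      (\<lambda>(F, G, Z). F * G ^ 2 + 2 * a' * F * G * Z - F ^ 2 * G - 2 * a' * b * Z ^ 3)"
    using cut_out_by_cmult[OF cut_out_by_T[OF disc_nonzero], of "- (2 * a' * b)"] by metis
qed

end

text \<open>The product is nested so that 2, \<open>a\<close> and \<open>b\<close> each appear as a
  factor whose vanishing would annihilate it.\<close>

lemma discriminant_split:
  "discriminant (Weierstrass 0 a 0 (- 2 * a * b) (a * b ^ 2))
     = 2 * (a * (b * (- (8 * a * b ^ 2 * (4 * a + 27 * b)))))"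
  by (simp add: discriminant_def b2_def b4_def b6_def b8_def algebra_simps
      power2_eq_square power3_eq_cube)

text \<open>An induced map is arbitrary off the curve, so the claim combines existence with a
  statement on every such map.\<close>

theorem lemma4p3:
  fixes v :: "'a::alg_closed_field \<Rightarrow> ereal"
    and a b a' :: 'a
    and W :: "'a weierstrass"
    and f g :: "'a fractions"
  assumes "nonarch_valuation v"
    and "ring_char (residue_field v) \<noteq> 2" and "ring_char (residue_field v) \<noteq> 3"
    and "a \<in> carrier (valuation_ring v)" and "b \<in> carrier (valuation_ring v)"
    and "W = Weierstrass 0 a 0 (- 2 * a * b) (a * b ^ 2)"
    and "elliptic W"
    and "v (j_invariant W) < 0"
    and "minimal_weierstrass v W"
    and "\<exists>y. Affine 0 y \<in> torsion W 3 \<and>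
           (\<exists>Q \<in> singular_points (residue_field v) (reduced_weierstrass v W).
              reduces_to v (point_proj (Affine 0 y)) Q)"
    and "a' ^ 2 = a"
    and "f = rat_fun W (\<lambda>x y. x ^ 2) (\<lambda>x y. y - a' * (x - b))"
    and "g = rat_fun W (\<lambda>x y. x ^ 2) (\<lambda>x y. y + a' * (x - b))"
  shows "(\<exists>\<phi>. induced_morphism W f g \<phi>) \<and>
    (\<forall>\<phi>. induced_morphism W f g \<phi> \<longrightarrow>
       embedding (curve W) \<phi> \<and>
       cut_out_by (\<phi> ` curve W)
         (\<lambda>(F, G, Z). F * G ^ 2 + 2 * a' * F * G * Z - F ^ 2 * G - 2 * a' * b * Z ^ 3))"
proof -
  have "2 * (a * (b * (- (8 * a * b ^ 2 * (4 * a + 27 * b))))) \<noteq> 0"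
    using \<open>elliptic W\<close> unfolding elliptic_def \<open>W = _\<close> discriminant_split .
  then have "(2 :: 'a) \<noteq> 0" "a \<noteq> 0" "b \<noteq> 0"
    by (metis mult_zero_left mult_zero_right)+
  then interpret split_weierstrass a' b
    using \<open>a' ^ 2 = a\<close> by unfold_locales auto
  show ?thesis
    unfolding \<open>f = _\<close> \<open>g = _\<close> \<open>W = _\<close> \<open>a' ^ 2 = a\<close>[symmetric] W_def[symmetric]
    using induced_morphism_L embedding_cut_out by blast
qed

end
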